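(* Let $v_1\le v_2\le v_3$ be positive integers with $v_2\ge 2v_1$ (and $v_1\ge 2$). Then an optimal $(\bar{1},2)$-LA$(v_2v_3;3,(v_1,v_2,v_3))$ exists, i.e. a $(\bar1,2)$-LA with $v_2v_3$ rows, and $v_2v_3=(\bar1,2)\text{-LAN}(3,(v_1,v_2,v_3))$.
   Context: For positive integers $N,k,t$ with $t<k$ and $v_1,\dots,v_k$, consider $N\times k$ arrays $A=(a_{rj})$ whose $j$-th column has entries from a set $V_j$ with $|V_j|=v_j$. A $t$-way interaction is $T=\{(j,\sigma_j):j\in I\}$ with $I\subseteq\{1,\dots,k\}$, $|I|=t$, $\sigma_j\in V_j$; $\rho(A,T)$ is the set of rows $r$ with $a_{rj}=\sigma_j$ for all $j\in I$, and $\rho(A,\mathcal T)=\bigcup_{T\in\mathcal T}\rho(A,T)$. $A$ is a $(\bar1,t)$-LA$(N;k,(v_1,\dots,v_k))$ if for all sets $\mathcal T_1,\mathcal T_2$ of $t$-way interactions with $|\mathcal T_1|,|\mathcal T_2|\le 1$: $\rho(A,\mathcal T_1)=\rho(A,\mathcal T_2)\iff\mathcal T_1=\mathcal T_2$ (equivalently: every $t$-way interaction occurs in some row and distinct interactions have distinct $\rho$). $(\bar1,t)$-LAN$(k,(v_1,\dots,v_k))$ is the minimum $N$ for which such an array exists; an LA attaining it is optimal. Throughout the paper all $v_j\ge2$. *)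

theory Defs
  imports Main
begin

text \<open>
  Rows are indexed by \<open>{1..N}\<close> and columns by \<open>{1..k}\<close>; an array is a function
  \<open>A r j\<close> whose values outside these ranges are irrelevant. The level
  vector \<open>(v\<^sub>1, \<dots>, v\<^sub>k)\<close> is a function \<open>v\<close>, and \<open>V j\<close> is the set of symbols
  of column \<open>j\<close>.
\<close>

definition is_array :: "nat \<Rightarrow> nat \<Rightarrow> (nat \<Rightarrow> nat) \<Rightarrow> (nat \<Rightarrow> 'a set) \<Rightarrow> (nat \<Rightarrow> nat \<Rightarrow> 'a) \<Rightarrow> bool" where
  "is_array N k v V A \<longleftrightarrow>
     (\<forall>j\<in>{1..k}. finite (V j) \<and> card (V j) = v j) \<and>
     (\<forall>r\<in>{1..N}. \<forall>j\<in>{1..k}. A r j \<in> V j)"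

definition interactions :: "nat \<Rightarrow> nat \<Rightarrow> (nat \<Rightarrow> 'a set) \<Rightarrow> (nat \<times> 'a) set set" where
  "interactions t k V =
     {T. \<exists>I \<sigma>. I \<subseteq> {1..k} \<and> card I = t \<and> (\<forall>j\<in>I. \<sigma> j \<in> V j) \<and> T = {(j, \<sigma> j) |j. j \<in> I}}"

definition rho :: "nat \<Rightarrow> (nat \<Rightarrow> nat \<Rightarrow> 'a) \<Rightarrow> (nat \<times> 'a) set \<Rightarrow> nat set" where
  "rho N A T = {r \<in> {1..N}. \<forall>(j, s)\<in>T. A r j = s}"

definition rho_set :: "nat \<Rightarrow> (nat \<Rightarrow> nat \<Rightarrow> 'a) \<Rightarrow> (nat \<times> 'a) set set \<Rightarrow> nat set" where
  "rho_set N A \<T> = (\<Union>T\<in>\<T>. rho N A T)"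

text \<open>\<open>locating_array t N k v V A\<close>: the array \<open>A\<close> over the symbol sets \<open>V\<close> is a
  \<open>(1-bar, t)-LA(N; k, v)\<close>.\<close>

definition locating_array ::
    "nat \<Rightarrow> nat \<Rightarrow> nat \<Rightarrow> (nat \<Rightarrow> nat) \<Rightarrow> (nat \<Rightarrow> 'a set) \<Rightarrow> (nat \<Rightarrow> nat \<Rightarrow> 'a) \<Rightarrow> bool" where
  "locating_array t N k v V A \<longleftrightarrow>
     0 < N \<and> 0 < t \<and> t < k \<and> is_array N k v V A \<and>
     (\<forall>\<T>\<^sub>1 \<T>\<^sub>2. \<T>\<^sub>1 \<subseteq> interactions t k V \<and> finite \<T>\<^sub>1 \<and> card \<T>\<^sub>1 \<le> 1 \<and>
                \<T>\<^sub>2 \<subseteq> interactions t k V \<and> finite \<T>\<^sub>2 \<and> card \<T>\<^sub>2 \<le> 1 \<longrightarrow>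
        (rho_set N A \<T>\<^sub>1 = rho_set N A \<T>\<^sub>2 \<longleftrightarrow> \<T>\<^sub>1 = \<T>\<^sub>2))"

text \<open>The locating array number depends only on the sizes of the symbol sets. All
  symbol sets are finite, so taking the symbols from \<open>nat\<close> loses no generality.
  The value is meaningful only when some locating array with these parameters exists.\<close>

definition LAN :: "nat \<Rightarrow> nat \<Rightarrow> (nat \<Rightarrow> nat) \<Rightarrow> nat" where
  "LAN t k v = (LEAST N. \<exists>(V :: nat \<Rightarrow> nat set) A. locating_array t N k v V A)"

definition optimal_locating_array ::
    "nat \<Rightarrow> nat \<Rightarrow> nat \<Rightarrow> (nat \<Rightarrow> nat) \<Rightarrow> (nat \<Rightarrow> 'a set) \<Rightarrow> (nat \<Rightarrow> nat \<Rightarrow> 'a) \<Rightarrow> bool" where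
  "optimal_locating_array t N k v V A \<longleftrightarrow> locating_array t N k v V A \<and> N = LAN t k v"

end

theory Submission
  imports Defs "HOL-Library.FuncSet"
begin

text \<open>
  Every pair of symbols from the two largest columns must occur in some row, and distinct pairs
  occur in different rows; this is the lower bound. For the construction, let the rows run through
  all pairs \<open>(y, z)\<close> of indices for columns 2 and 3, once each, and put \<open>(y + z) mod v\<^sub>1\<close> in
  column 1. Since \<open>v\<^sub>2, v\<^sub>3 \<ge> 2 v\<^sub>1\<close>, every interaction involving column 1 occurs at least twice, so
  it cannot be confused with an interaction of columns 2 and 3. An interaction of columns 1 and 2
  differs from one of columns 1 and 3, as two rows agreeing in both columns 2 and 3 coincide.
\<close>

section \<open>Reformulation of the locating property\<close>

lemma card_le_one_cases:
  assumes "finite S" "card S \<le> 1"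
  obtains "S = {}" | x where "S = {x}"
  using assms by (metis card_0_eq card_1_singletonE le_neq_implies_less less_one)

text \<open>Comparing \<open>{T}\<close> with \<open>{}\<close> amounts to covering, as the empty
  family has empty \<open>rho_set\<close>; comparing two singletons amounts to injectivity. Families
  with at most one member allow no other nontrivial comparison.\<close>

lemma locating_array_iff:
  "locating_array t N k v V A \<longleftrightarrow>
     0 < N \<and> 0 < t \<and> t < k \<and> is_array N k v V A \<and>
     (\<forall>T\<in>interactions t k V. rho N A T \<noteq> {}) \<and> inj_on (rho N A) (interactions t k V)"
    (is "?L \<longleftrightarrow> ?R")
proof
  assume L: ?L
  have sep: "rho_set N A T1 = rho_set N A T2 \<longleftrightarrow> T1 = T2"
    if "T1 \<subseteq> interactions t k V" "finite T1" "card T1 \<le> 1"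
      "T2 \<subseteq> interactions t k V" "finite T2" "card T2 \<le> 1" for T1 T2
    using L that unfolding locating_array_def by blast
  have "rho N A T \<noteq> {}" if "T \<in> interactions t k V" for T
    using sep[of "{T}" "{}"] that by (simp add: rho_set_def)
  moreover have "inj_on (rho N A) (interactions t k V)"
  proof (rule inj_onI)
    fix S T assume "S \<in> interactions t k V" "T \<in> interactions t k V" "rho N A S = rho N A T"
    then show "S = T"
      using sep[of "{S}" "{T}"] by (simp add: rho_set_def)
  qed
  ultimately show ?R
    using L unfolding locating_array_def by blast
next
  assume R: ?R
  have "rho_set N A T1 = rho_set N A T2 \<longleftrightarrow> T1 = T2"
    if T1: "T1 \<subseteq> interactions t k V" "finite T1" "card T1 \<le> 1"
      and T2: "T2 \<subseteq> interactions t k V" "finite T2" "card T2 \<le> 1" for T1 T2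
    by (rule card_le_one_cases[OF T1(2,3)]; rule card_le_one_cases[OF T2(2,3)])
      (use R T1 T2 in \<open>auto simp: rho_set_def inj_on_def\<close>)
  then show ?L
    using R unfolding locating_array_def by blast
qed

section \<open>Lower bound on the number of rows\<close>

lemma prod_levels_le_rows:
  assumes LA: "locating_array t N k v V A" and I: "I \<subseteq> {1..k}" "card I = t"
  shows "prod v I \<le> N"
proof -
  have fin: "finite I"
    using I finite_subset by blast
  \<comment> \<open>Each choice of symbols on \<open>I\<close> is an interaction and so is realised
    by a row; \<open>N\<close> rows have at most \<open>N\<close> restrictions to
    \<open>I\<close>.\<close>
  have "PiE I V \<subseteq> (\<lambda>r. restrict (A r) I) ` {1..N}"
  proof
    fix \<sigma> assume \<sigma>: "\<sigma> \<in> PiE I V"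
    have "{(j, \<sigma> j) |j. j \<in> I} \<in> interactions t k V"
      using I \<sigma> by (auto simp: interactions_def)
    then obtain r where r: "r \<in> rho N A {(j, \<sigma> j) |j. j \<in> I}"
      using LA by (auto simp: locating_array_iff)
    then have "A r j = \<sigma> j" if "j \<in> I" for j
      using that by (auto simp: rho_def)
    \<comment> \<open>Outside \<open>I\<close> both sides are \<open>undefined\<close>, as members
      of \<open>PiE I V\<close> are extensional.\<close>
    then have "\<sigma> = restrict (A r) I"
      using PiE_arb[OF \<sigma>] by (simp add: fun_eq_iff)
    moreover have "r \<in> {1..N}"
      using r by (simp add: rho_def)
    ultimately show "\<sigma> \<in> (\<lambda>r. restrict (A r) I) ` {1..N}"
      by blast
  qed
  then have "card (PiE I V) \<le> N"
    by (metis card_atLeastAtMost diff_Suc_1 finite_atLeastAtMost surj_card_le)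
  moreover have "card (PiE I V) = (\<Prod>j\<in>I. card (V j))"
    using fin by (rule card_PiE)
  moreover have "(\<Prod>j\<in>I. card (V j)) = prod v I"
    using LA I by (intro prod.cong) (auto simp: locating_array_def is_array_def)
  ultimately show ?thesis
    by simp
qed

section \<open>A locating criterion for pairs among three columns\<close>

lemma interactions_2_3_cases:
  assumes "T \<in> interactions 2 3 V"
  obtains x y where "x \<in> V 1" "y \<in> V 2" "T = {(1, x), (2, y)}"
    | x z where "x \<in> V 1" "z \<in> V 3" "T = {(1, x), (3, z)}"
    | y z where "y \<in> V 2" "z \<in> V 3" "T = {(2, y), (3, z)}"
proof -
  obtain I \<sigma> where I: "I \<subseteq> {1..3}" "card I = 2" and \<sigma>: "\<forall>j\<in>I. \<sigma> j \<in> V j"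
    and T: "T = {(j, \<sigma> j) |j. j \<in> I}"
    using assms by (auto simp: interactions_def)
  have "{1..3::nat} = {1, 2, 3}"
    by auto
  then have "I = {1, 2} \<or> I = {1, 3} \<or> I = {2, 3}"
    using I by (auto simp: card_2_iff)
  then show thesis
  proof (elim disjE)
    assume "I = {1, 2}"
    then show thesis using \<sigma> T by (intro that(1)[of "\<sigma> 1" "\<sigma> 2"]) auto
  next
    assume "I = {1, 3}"
    then show thesis using \<sigma> T by (intro that(2)[of "\<sigma> 1" "\<sigma> 3"]) auto
  next
    assume "I = {2, 3}"
    then show thesis using \<sigma> T by (intro that(3)[of "\<sigma> 2" "\<sigma> 3"]) auto
  qed
qed

lemma rho_pair:
  "rho N A {(i, s), (j, s')} = {r \<in> {1..N}. A r i = s \<and> A r j = s'}"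
  by (auto simp: rho_def)

lemma locating_array_2_3I:
  assumes "0 < N" and arr: "is_array N 3 v V A"
    and ex23: "\<And>y z. y \<in> V 2 \<Longrightarrow> z \<in> V 3 \<Longrightarrow> \<exists>r\<in>{1..N}. A r 2 = y \<and> A r 3 = z"
    and uniq23: "\<And>r s. r \<in> {1..N} \<Longrightarrow> s \<in> {1..N} \<Longrightarrow> A r 2 = A s 2 \<Longrightarrow> A r 3 = A s 3 \<Longrightarrow> r = s"
    and two12: "\<And>x y. x \<in> V 1 \<Longrightarrow> y \<in> V 2 \<Longrightarrow>
      \<exists>r\<in>{1..N}. \<exists>s\<in>{1..N}. r \<noteq> s \<and> A r 1 = x \<and> A r 2 = y \<and> A s 1 = x \<and> A s 2 = y"
    and two13: "\<And>x z. x \<in> V 1 \<Longrightarrow> z \<in> V 3 \<Longrightarrow>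
      \<exists>r\<in>{1..N}. \<exists>s\<in>{1..N}. r \<noteq> s \<and> A r 1 = x \<and> A r 3 = z \<and> A s 1 = x \<and> A s 3 = z"
  shows "locating_array 2 N 3 v V A"
proof -
  have covered: "rho N A T \<noteq> {}" if "T \<in> interactions 2 3 V" for T
    using that
  proof (cases rule: interactions_2_3_cases)
    case (1 x y)
    then show ?thesis using two12[of x y] by (auto simp: rho_pair)
  next
    case (2 x z)
    then show ?thesis using two13[of x z] by (auto simp: rho_pair)
  next
    case (3 y z)
    then show ?thesis using ex23[of y z] by (auto simp: rho_pair)
  qed
  have "S = T"
    if S: "S \<in> interactions 2 3 V" and T: "T \<in> interactions 2 3 V"
      and eq: "rho N A S = rho N A T" for S T
  proof -
    \<comment> \<open>A common row settles the case where both interactions lie on columns 2 and 3: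
      it determines both symbols.\<close>
    obtain r0 where r0: "r0 \<in> rho N A S" "r0 \<in> rho N A T"
      using covered[OF S] eq by auto
    show ?thesis
      using S
    proof (cases rule: interactions_2_3_cases)
      case S12: (1 x y)
      obtain r s where rs: "r \<in> {1..N}" "s \<in> {1..N}" "r \<noteq> s"
        "A r 1 = x" "A r 2 = y" "A s 1 = x" "A s 2 = y"
        using two12 S12 by blast
      then have "r \<in> rho N A T" "s \<in> rho N A T"
        using S12 by (auto simp: eq[symmetric] rho_pair)
      \<comment> \<open>The two rows agree in column 2, so they differ in column 3. Hence
        \<open>T\<close> cannot fix column 3; it lies on columns 1 and 2, with symbols read off from
        row \<open>r\<close>.\<close>
      then have "A r 3 \<noteq> A s 3"
        using uniq23 rs by auto
      with T show ?thesis
        by (cases rule: interactions_2_3_cases)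
          (use \<open>r \<in> rho N A T\<close> \<open>s \<in> rho N A T\<close> rs S12 in \<open>auto simp: rho_pair\<close>)
    next
      case S13: (2 x z)
      obtain r s where rs: "r \<in> {1..N}" "s \<in> {1..N}" "r \<noteq> s"
        "A r 1 = x" "A r 3 = z" "A s 1 = x" "A s 3 = z"
        using two13 S13 by blast
      then have "r \<in> rho N A T" "s \<in> rho N A T"
        using S13 by (auto simp: eq[symmetric] rho_pair)
      then have "A r 2 \<noteq> A s 2"
        using uniq23 rs by auto
      with T show ?thesis
        by (cases rule: interactions_2_3_cases)
          (use \<open>r \<in> rho N A T\<close> \<open>s \<in> rho N A T\<close> rs S13 in \<open>auto simp: rho_pair\<close>)
    next
      case S23: (3 y z)
      \<comment> \<open>Columns 2 and 3 determine the row, so \<open>rho N A T\<close> has at most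
        one element, whereas any interaction on column 1 has two rows.\<close>
      have single: "r = s" if "r \<in> rho N A T" "s \<in> rho N A T" for r s
        using that S23 by (intro uniq23) (auto simp: eq[symmetric] rho_pair)
      show ?thesis
        using T
      proof (cases rule: interactions_2_3_cases)
        case (1 x' y')
        then obtain r s where "r \<in> rho N A T" "s \<in> rho N A T" "r \<noteq> s"
          using two12[of x' y'] unfolding \<open>T = _\<close> rho_pair by blast
        then show ?thesis
          using single by blast
      next
        case (2 x' z')
        then obtain r s where "r \<in> rho N A T" "s \<in> rho N A T" "r \<noteq> s"
          using two13[of x' z'] unfolding \<open>T = _\<close> rho_pair by blast
        then show ?thesis
          using single by blast
      next
        case (3 y' z')
        then show ?thesis
          using r0 S23 by (auto simp: rho_pair)
      qed
    qed
  qed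
  then show ?thesis
    using assms(1) arr covered by (auto simp: locating_array_iff inj_on_def)
qed

section \<open>Construction by sums modulo \<open>v 1\<close>\<close>

lemma two_shifts_mod_eq:
  fixes a n x y :: nat
  assumes "x < a" "2 * a \<le> n"
  obtains z z' where "z < n" "z' < n" "z \<noteq> z'" "(y + z) mod a = x" "(y + z') mod a = x"
proof -
  \<comment> \<open>The residue of \<open>x - y\<close> modulo \<open>a\<close>, written so that
    subtraction on the naturals is not truncated.\<close>
  define z where "z = (x + (a - y mod a)) mod a"
  have "(y + z) mod a = (y mod a + (x + (a - y mod a))) mod a"
    by (simp add: z_def mod_simps)
  also have "y mod a + (x + (a - y mod a)) = x + a"
    using assms mod_less_divisor[of a y] by linarith
  finally have "(y + z) mod a = x"
    using assms by simp
  \<comment> \<open>The second solution is \<open>z + a\<close>; since \<open>z < a\<close>, both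
    lie below \<open>2 * a \<le> n\<close>.\<close>
  moreover from this have "(y + (z + a)) mod a = x"
    by (metis add.assoc mod_add_self2)
  moreover have "z < a"
    using assms by (simp add: z_def)
  ultimately show thesis
    using assms that[of z "z + a"] by simp
qed

text \<open>The symbol type is arbitrary because the construction serves both the given
  \<open>V\<close> and the natural-number symbols over which \<open>LAN\<close> is defined.\<close>

lemma ex_locating_array_2_3:
  fixes v :: "nat \<Rightarrow> nat" and V :: "nat \<Rightarrow> 'a set"
  assumes pos: "0 < v 1" and le2: "2 * v 1 \<le> v 2" and le3: "2 * v 1 \<le> v 3"
    and V: "\<forall>j\<in>{1..3}. finite (V j) \<and> card (V j) = v j"
  shows "\<exists>A. locating_array 2 (v 2 * v 3) 3 v V A"
proof -
  define N where "N = v 2 * v 3"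
  have "\<exists>e. bij_betw e {..<v j} (V j)" if "j \<in> {1..3}" for j
    using V that ex_bij_betw_nat_finite[of "V j"] by (auto simp: atLeast0LessThan)
  \<comment> \<open>Numbering the symbols of each column transfers modular arithmetic to arbitrary
    symbol sets.\<close>
  then obtain e where e: "\<And>j. j \<in> {1..3} \<Longrightarrow> bij_betw (e j) {..<v j} (V j)"
    by metis
  have e_in: "e j n \<in> V j" if "j \<in> {1..3}" "n < v j" for j n
    using bij_betwE[OF e] that by blast
  have e_surj: "\<exists>n<v j. s = e j n" if "j \<in> {1..3}" "s \<in> V j" for j s
    using bij_betw_imp_surj_on[OF e] that by blast
  have e_inj: "m = n" if "j \<in> {1..3}" "m < v j" "n < v j" "e j m = e j n" for j m n
    using bij_betw_imp_inj_on[OF e] that by (auto simp: inj_on_def)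
  \<comment> \<open>Rows are numbered from 1, so \<open>r - 1\<close> is split into quotient and
    remainder by \<open>v 3\<close>; \<open>row\<close> is the inverse encoding.\<close>
  define Y where "Y = (\<lambda>r. (r - 1) div v 3)"
  define Z where "Z = (\<lambda>r. (r - 1) mod v 3)"
  define row where "row = (\<lambda>y z. y * v 3 + z + 1)"
  define A where "A = (\<lambda>r j. if j = (1::nat) then e 1 ((Y r + Z r) mod v 1)
    else if j = 2 then e 2 (Y r) else e 3 (Z r))"
  have Y_less: "Y r < v 2" if "r \<in> {1..N}" for r
    using that by (auto simp: Y_def N_def less_mult_imp_div_less)
  have Z_less: "Z r < v 3" for r
    using pos le3 by (simp add: Z_def)
  have row: "row y z \<in> {1..N}" "Y (row y z) = y" "Z (row y z) = z" if "y < v 2" "z < v 3" for y z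
  proof -
    have "y * v 3 + z < Suc y * v 3"
      using that by simp
    also have "\<dots> \<le> N"
      unfolding N_def using that by (intro mult_le_mono1) simp
    finally show "row y z \<in> {1..N}"
      by (simp add: row_def)
  qed (use that in \<open>simp_all add: row_def Y_def Z_def\<close>)
  have row_inj: "y = y' \<and> z = z'"
    if "row y z = row y' z'" "y < v 2" "z < v 3" "y' < v 2" "z' < v 3" for y y' z z'
    using that row by metis
  have A_row: "A (row y z) 1 = e 1 ((y + z) mod v 1)" "A (row y z) 2 = e 2 y" "A (row y z) 3 = e 3 z"
    if "y < v 2" "z < v 3" for y z
    using that row by (simp_all add: A_def)
  have "locating_array 2 N 3 v V A"
  proof (rule locating_array_2_3I)
    show "0 < N"
      using pos le2 le3 by (simp add: N_def)
  next
    have "{1..3::nat} = {1, 2, 3}"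
      by auto
    then have "A r j \<in> V j" if "r \<in> {1..N}" "j \<in> {1..3}" for r j
      using that pos Y_less[of r] Z_less[of r] e_in[of 1] e_in[of 2] e_in[of 3]
      by (auto simp: A_def)
    then show "is_array N 3 v V A"
      using V by (simp add: is_array_def)
  next
    fix y z assume "y \<in> V 2" "z \<in> V 3"
    then obtain m n where "m < v 2" "y = e 2 m" "n < v 3" "z = e 3 n"
      using e_surj[of 2 y] e_surj[of 3 z] by auto
    then show "\<exists>r\<in>{1..N}. A r 2 = y \<and> A r 3 = z"
      using row by (intro bexI[of _ "row m n"]) (auto simp: A_def)
  next
    fix r s assume rs: "r \<in> {1..N}" "s \<in> {1..N}" "A r 2 = A s 2" "A r 3 = A s 3"
    have "Y r = Y s" "Z r = Z s"
      using rs e_inj[of 2 "Y r" "Y s"] e_inj[of 3 "Z r" "Z s"] Y_less Z_less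
      by (auto simp: A_def)
    then have "r - 1 = s - 1"
      unfolding Y_def Z_def by (metis div_mult_mod_eq)
    \<comment> \<open>Both row numbers are at least 1, so \<open>r - 1 = s - 1\<close> loses nothing
      to truncation.\<close>
    then show "r = s"
      using rs(1,2) unfolding atLeastAtMost_iff by linarith
  next
    fix x y assume "x \<in> V 1" "y \<in> V 2"
    then obtain l m where lm: "l < v 1" "x = e 1 l" "m < v 2" "y = e 2 m"
      using e_surj[of 1 x] e_surj[of 2 y] by auto
    \<comment> \<open>With the index of column 2 fixed, that of column 3 ranges over
      \<open>v 3 \<ge> 2 * v 1\<close> values and meets the residue \<open>l\<close> twice.\<close>
    obtain n n' where "n < v 3" "n' < v 3" "n \<noteq> n'" "(m + n) mod v 1 = l" "(m + n') mod v 1 = l"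
      using two_shifts_mod_eq[OF lm(1) le3] .
    moreover from this have "row m n \<noteq> row m n'"
      using row_inj lm by blast
    ultimately show "\<exists>r\<in>{1..N}. \<exists>s\<in>{1..N}. r \<noteq> s \<and> A r 1 = x \<and> A r 2 = y \<and> A s 1 = x \<and> A s 2 = y"
      using lm row[of m n] row[of m n'] A_row by (metis (no_types))
  next
    fix x z assume "x \<in> V 1" "z \<in> V 3"
    then obtain l n where ln: "l < v 1" "x = e 1 l" "n < v 3" "z = e 3 n"
      using e_surj[of 1 x] e_surj[of 3 z] by auto
    \<comment> \<open>Now column 2 varies, which takes \<open>2 * v 1 \<le> v 2\<close>; the
      summands are swapped relative to \<open>A\<close>, hence \<open>add.commute\<close>
      below.\<close>
    obtain m m' where "m < v 2" "m' < v 2" "m \<noteq> m'" "(n + m) mod v 1 = l" "(n + m') mod v 1 = l"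
      using two_shifts_mod_eq[OF ln(1) le2] .
    moreover from this have "row m n \<noteq> row m' n"
      using row_inj ln by blast
    ultimately show "\<exists>r\<in>{1..N}. \<exists>s\<in>{1..N}. r \<noteq> s \<and> A r 1 = x \<and> A r 3 = z \<and> A s 1 = x \<and> A s 3 = z"
      using ln row[of m n] row[of m' n] A_row by (metis (no_types) add.commute)
  qed
  then show ?thesis
    unfolding N_def by blast
qed

theorem theorem4p18:
  fixes v :: "nat \<Rightarrow> nat" and V :: "nat \<Rightarrow> 'a set"
  assumes "2 \<le> v 1" and "v 1 \<le> v 2" and "v 2 \<le> v 3" and "2 * v 1 \<le> v 2"
    and "\<forall>j\<in>{1..3}. finite (V j) \<and> card (V j) = v j"
  shows "(\<exists>A. optimal_locating_array 2 (v 2 * v 3) 3 v V A) \<and> v 2 * v 3 = LAN 2 3 v"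
proof -
  have pos: "0 < v 1" and le3: "2 * v 1 \<le> v 3"
    using assms by auto
  have "LAN 2 3 v = v 2 * v 3"
    unfolding LAN_def
  proof (rule Least_equality)
    show "\<exists>(W :: nat \<Rightarrow> nat set) A. locating_array 2 (v 2 * v 3) 3 v W A"
      using ex_locating_array_2_3[of v "\<lambda>j. {..<v j}"] pos assms(4) le3 by auto
  next
    fix N assume "\<exists>(W :: nat \<Rightarrow> nat set) A. locating_array 2 N 3 v W A"
    then show "v 2 * v 3 \<le> N"
      \<comment> \<open>Columns 2 and 3 have the most symbols, so this pair gives the largest of the
        three product bounds.\<close>
      using prod_levels_le_rows[of 2 N 3 v _ _ "{2, 3}"] by auto
  qed
  then show ?thesis
    using ex_locating_array_2_3[OF pos assms(4) le3 assms(5)]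
    by (auto simp: optimal_locating_array_def)
qed

end
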